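(* Let $I\subseteq\mathbb{F}_q[X_1,\ldots,X_m]$ be an ideal, $\prec$ a monomial ordering, $n=\#\Delta_\prec(I_q)$, and let $F_1,\ldots,F_n$ be polynomials, linearly independent over $\mathbb{F}_q$, all with support in $\Delta_\prec(I_q)$. Put $\vec b_i=\mathrm{ev}(F_i)$, let $B$ be the $n\times n$ matrix with rows $\vec b_1,\ldots,\vec b_n$, and let $\vec b_1^\perp,\ldots,\vec b_n^\perp$ be the vectors whose transposes are the columns, in order, of $B^{-1}$. For $i=1,\ldots,n$, write $\vec b_i^\perp=(c_1,\ldots,c_n)$ and set $F_i^\perp=\sum_{s=1}^n c_sL_{P_s}^{(V)}$; this is a polynomial with support in $\Delta_\prec(I_q)$ and $\mathrm{ev}(F_i^\perp)=\vec b_i^\perp$. Then for every set of pairwise different indices $\{i_1,\ldots,i_{n-k}\}\subseteq\{1,\ldots,n\}$, $$\big(\mathrm{Span}_{\mathbb{F}_q}\{\mathrm{ev}(F_{i_1}),\ldots,\mathrm{ev}(F_{i_{n-k}})\}\big)^\perp=\mathrm{Span}_{\mathbb{F}_q}\{\mathrm{ev}(F_j^\perp)\mid j\in\{1,\ldots,n\}\setminus\{i_1,\ldots,i_{n-k}\}\}.$$ In particular, if $F_1=M_1,\ldots,F_n=M_n$ where $\Delta_\prec(I_q)=\{M_1,\ldots,M_n\}$ with $M_i\prec M_j$ for $i<j$, then for any $L\subseteq\Delta_\prec(I_q)$, $$C^\perp(I,L)=\mathrm{Span}_{\mathbb{F}_q}\{\mathrm{ev}(F_i^\perp)\mid M_i\notin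 L\}.$$
   Context: $\mathbb{F}_q$ is the finite field with $q$ elements. For an ideal $J$ of $\mathbb{F}_q[X_1,\ldots,X_m]$ the footprint $\Delta_\prec(J)$ is the set of monomials that are not the leading monomial (w.r.t. $\prec$) of any polynomial in $J$. Put $I_q=I+\langle X_1^q-X_1,\ldots,X_m^q-X_m\rangle$. The variety $V=\mathbb{V}(I_q)=\{P_1,\ldots,P_n\}\subseteq\mathbb{F}_q^m$ has $n=\#\Delta_\prec(I_q)$ elements, and $\mathrm{ev}(F)=(F(P_1),\ldots,F(P_n))$ induces a vector space isomorphism $\mathbb{F}_q[X_1,\ldots,X_m]/I_q\to\mathbb{F}_q^n$. For $L\subseteq\Delta_\prec(I_q)$, $C(I,L)=\mathrm{Span}_{\mathbb{F}_q}\{\mathrm{ev}(M)\mid M\in L\}$, and $C^\perp(I,L)$ is its dual code with respect to the standard bilinear form. For $a=(a_1,\ldots,a_m)\in V$ the Lagrange basis polynomial is $L_a=\prod_{i=1}^m\prod_{s\in\mathbb{F}_q\setminus\{a_i\}}\frac{X_i-s}{a_i-s}$, and $L_a^{(V)}$ is the remainder of $L_a$ modulo a Gröbner basis of $I_q$ with respect to $\prec$ (so its support is contained in $\Delta_\prec(I_q)$ and it takes the same values on $V$ as $L_a$). *)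

theory Defs
  imports
    "HOL-Library.Poly_Mapping"
    "Jordan_Normal_Form.Gauss_Jordan_Elimination"
    "Jordan_Normal_Form.VS_Connect"
begin

section \<open>Multivariate polynomials over a finite field\<close>

text \<open>
  The variables \<open>X\<^sub>1, \<dots>, X\<^sub>m\<close> are indexed by a finite type \<open>'m\<close>, and a monomial is identified with
  its exponent vector, so that multiplication of monomials is addition of exponent vectors.
\<close>

type_synonym 'm monomial = "'m \<Rightarrow>\<^sub>0 nat"
type_synonym ('m, 'a) mpoly = "'m monomial \<Rightarrow>\<^sub>0 'a"

definition Const :: "'a \<Rightarrow> ('m, 'a::comm_ring_1) mpoly" where
  "Const c = Poly_Mapping.single 0 c"

definition Monom :: "'m monomial \<Rightarrow> ('m, 'a::comm_ring_1) mpoly" where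
  "Monom t = Poly_Mapping.single t 1"

definition Var :: "'m \<Rightarrow> ('m, 'a::comm_ring_1) mpoly" where
  "Var i = Monom (Poly_Mapping.single i 1)"

definition poly_eval :: "('m::finite, 'a::comm_ring_1) mpoly \<Rightarrow> ('m \<Rightarrow> 'a) \<Rightarrow> 'a" where
  "poly_eval f a = (\<Sum>t\<in>Poly_Mapping.keys f. Poly_Mapping.lookup f t * (\<Prod>i\<in>UNIV. a i ^ Poly_Mapping.lookup t i))"

text \<open>Ideals of a commutative ring are its submodules as a module over itself.\<close>

abbreviation is_ideal :: "'r::comm_ring_1 set \<Rightarrow> bool" where
  "is_ideal J \<equiv> Modules.module.subspace (*) J"

abbreviation ideal_gen :: "'r::comm_ring_1 set \<Rightarrow> 'r set" where
  "ideal_gen S \<equiv> Modules.module.span (*) S"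

definition lin_indep_family :: "nat \<Rightarrow> (nat \<Rightarrow> ('m, 'a::comm_ring_1) mpoly) \<Rightarrow> bool" where
  "lin_indep_family n F \<longleftrightarrow>
     inj_on F {0..<n} \<and> \<not> Modules.module.dependent (\<lambda>c f. Const c * f) (F ` {0..<n})"

section \<open>Monomial orderings, footprints, Groebner bases\<close>

definition monomial_order :: "('m monomial \<Rightarrow> 'm monomial \<Rightarrow> bool) \<Rightarrow> bool" where
  "monomial_order lt \<longleftrightarrow>
     class.wellorder lt\<^sup>=\<^sup>= lt \<and> (\<forall>s t u. lt s t \<longrightarrow> lt (s + u) (t + u))"

text \<open>Meaningful for nonzero polynomials only.\<close>

definition lead_monom ::
    "('m monomial \<Rightarrow> 'm monomial \<Rightarrow> bool) \<Rightarrow> ('m, 'a::zero) mpoly \<Rightarrow> 'm monomial" where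
  "lead_monom lt f = (THE t. t \<in> Poly_Mapping.keys f \<and> (\<forall>s\<in>Poly_Mapping.keys f. lt\<^sup>=\<^sup>= s t))"

definition footprint ::
    "('m monomial \<Rightarrow> 'm monomial \<Rightarrow> bool) \<Rightarrow> ('m, 'a::zero) mpoly set \<Rightarrow> 'm monomial set" where
  "footprint lt J = {t. \<not> (\<exists>f\<in>J. f \<noteq> 0 \<and> lead_monom lt f = t)}"

definition monom_dvd :: "'m monomial \<Rightarrow> 'm monomial \<Rightarrow> bool" where
  "monom_dvd s t \<longleftrightarrow> (\<exists>u. t = s + u)"

definition groebner_basis ::
    "('m monomial \<Rightarrow> 'm monomial \<Rightarrow> bool) \<Rightarrow> ('m, 'a::zero) mpoly set \<Rightarrow> ('m, 'a) mpoly set \<Rightarrow> bool" where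
  "groebner_basis lt J G \<longleftrightarrow> finite G \<and> G \<subseteq> J \<and> 0 \<notin> G \<and>
     (\<forall>f\<in>J. f \<noteq> 0 \<longrightarrow> (\<exists>g\<in>G. monom_dvd (lead_monom lt g) (lead_monom lt f)))"

text \<open>
  \<open>r\<close> is a remainder of \<open>f\<close> on division by \<open>G\<close>, in the sense of the multivariate division algorithm;
  it is unique if \<open>G\<close> is a Groebner basis.
\<close>

definition is_remainder ::
    "('m monomial \<Rightarrow> 'm monomial \<Rightarrow> bool) \<Rightarrow> ('m, 'a::comm_ring_1) mpoly set \<Rightarrow>
     ('m, 'a) mpoly \<Rightarrow> ('m, 'a) mpoly \<Rightarrow> bool" where
  "is_remainder lt G f r \<longleftrightarrow>
     (\<exists>Q. f = (\<Sum>g\<in>G. Q g * g) + r \<and>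
          (\<forall>g\<in>G. Q g * g \<noteq> 0 \<longrightarrow> f \<noteq> 0 \<and> lt\<^sup>=\<^sup>= (lead_monom lt (Q g * g)) (lead_monom lt f))) \<and>
     (\<forall>t\<in>Poly_Mapping.keys r. \<forall>g\<in>G. \<not> monom_dvd (lead_monom lt g) t)"

definition remainder ::
    "('m monomial \<Rightarrow> 'm monomial \<Rightarrow> bool) \<Rightarrow> ('m, 'a::comm_ring_1) mpoly set \<Rightarrow>
     ('m, 'a) mpoly \<Rightarrow> ('m, 'a) mpoly" where
  "remainder lt G f = (THE r. is_remainder lt G f r)"

section \<open>Affine variety codes\<close>

definition Iq :: "('m::finite, 'a::{field,finite}) mpoly set \<Rightarrow> ('m, 'a) mpoly set" where
  "Iq I = {f + g | f g. f \<in> I \<and> g \<in> ideal_gen {Var i ^ card (UNIV :: 'a set) - Var i | i. True}}"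

definition variety :: "('m::finite, 'a::comm_ring_1) mpoly set \<Rightarrow> ('m \<Rightarrow> 'a) set" where
  "variety J = {a. \<forall>f\<in>J. poly_eval f a = 0}"

text \<open>
  The points of the variety are enumerated as \<open>P 0, \<dots>, P (n - 1)\<close>; as usual for this vector library,
  all indices run over \<open>{0..<n}\<close> instead of \<open>{1..n}\<close>.
\<close>

definition ev :: "nat \<Rightarrow> (nat \<Rightarrow> 'm::finite \<Rightarrow> 'a) \<Rightarrow> ('m, 'a::comm_ring_1) mpoly \<Rightarrow> 'a vec" where
  "ev n P f = vec n (\<lambda>s. poly_eval f (P s))"

definition code_span :: "nat \<Rightarrow> 'a::field vec set \<Rightarrow> 'a vec set" where
  "code_span n S = LinearCombinations.module.span class_ring (module_vec TYPE('a) n) S"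

definition dual_code :: "nat \<Rightarrow> 'a::field vec set \<Rightarrow> 'a vec set" where
  "dual_code n C = vec_module.orthogonal_complement n C"

definition variety_code ::
    "nat \<Rightarrow> (nat \<Rightarrow> 'm::finite \<Rightarrow> 'a) \<Rightarrow> 'm monomial set \<Rightarrow> 'a::field vec set" where
  "variety_code n P L = code_span n {ev n P (Monom t :: ('m, 'a) mpoly) | t. t \<in> L}"

definition lagrange_poly :: "('m::finite \<Rightarrow> 'a) \<Rightarrow> ('m, 'a::{field,finite}) mpoly" where
  "lagrange_poly a =
     (\<Prod>i\<in>UNIV. \<Prod>s\<in>UNIV - {a i}. Const (1 / (a i - s)) * (Var i - Const s))"

definition ev_matrix ::
    "nat \<Rightarrow> (nat \<Rightarrow> 'm::finite \<Rightarrow> 'a) \<Rightarrow> (nat \<Rightarrow> ('m, 'a::comm_ring_1) mpoly) \<Rightarrow> 'a mat" where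
  "ev_matrix n P F = mat_of_rows n (map (\<lambda>i. ev n P (F i)) [0..<n])"

definition perp_vec ::
    "nat \<Rightarrow> (nat \<Rightarrow> 'm::finite \<Rightarrow> 'a) \<Rightarrow> (nat \<Rightarrow> ('m, 'a::field) mpoly) \<Rightarrow> nat \<Rightarrow> 'a vec" where
  "perp_vec n P F i = col (the (mat_inverse (ev_matrix n P F))) i"

text \<open>\<open>G\<close> is the Groebner basis used to form the remainders of the Lagrange basis polynomials.\<close>

definition perp_poly ::
    "('m::finite monomial \<Rightarrow> 'm monomial \<Rightarrow> bool) \<Rightarrow> ('m, 'a) mpoly set \<Rightarrow> nat \<Rightarrow> (nat \<Rightarrow> 'm \<Rightarrow> 'a) \<Rightarrow>
     (nat \<Rightarrow> ('m, 'a::{field,finite}) mpoly) \<Rightarrow> nat \<Rightarrow> ('m, 'a) mpoly" where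
  "perp_poly lt G n P F i =
     (\<Sum>s<n. Const (perp_vec n P F i $ s) * remainder lt G (lagrange_poly (P s)))"

end

(* The Lagrange polynomials L_a, a in F_q^m, sum to 1, and X_i * L_a = a_i * L_a modulo the field
   equations; hence f is congruent to the sum of the f(a) * L_a modulo I_q, and L_a lies in I_q when a
   is not in V. So a polynomial vanishing on V lies in I_q, and evaluation on V is injective on the
   span of the footprint; it is surjective because the remainders of the L_a, a in V, evaluate to
   unit vectors. Counting both sides over the finite field gives #footprint = #V. The matrix B is
   then invertible, and the rows of B and the columns of its inverse are dual bases. *)

theory Submission
  imports Defs "Jordan_Normal_Form.Char_Poly"
begin

section \<open>Evaluation of polynomials\<close>

text \<open>The identities for \<open>lagrange_poly\<close> must hold between polynomials, the
  eigenvector relation up to the field equations: equal values at all points do not give equality in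
  the polynomial ring. They are therefore proved for univariate polynomials, where degree below q
  together with vanishing everywhere forces zero, and carried over by substituting a variable for
  the indeterminate. Finiteness of the footprint has to be proved too: the \<open>card\<close> of an
  infinite set is 0, so \<open>n\<close> counts monomials only afterwards. Hence the upper bound is
  first shown for finite subsets of the footprint. Cardinalities stand in for dimensions: t
  monomials support q^t polynomials, the points of V carry q^(card V) value tables, and since q > 1
  an inequality of powers is one of exponents.\<close>

lemma poly_mapping_eq_sum_single:
  "f = (\<Sum>t\<in>Poly_Mapping.keys f. Poly_Mapping.single t (Poly_Mapping.lookup f t))"
  by (rule poly_mapping_eqI)
    (simp add: lookup_sum lookup_single when_def in_keys_iff sum.delta')

lemma poly_eval_superset:
  assumes "finite A" "Poly_Mapping.keys f \<subseteq> A"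
  shows "poly_eval f a =
    (\<Sum>t\<in>A. Poly_Mapping.lookup f t * (\<Prod>i\<in>UNIV. a i ^ Poly_Mapping.lookup t i))"
  unfolding poly_eval_def using assms
  by (intro sum.mono_neutral_left) (auto simp: in_keys_iff)

lemma poly_eval_single:
  "poly_eval (Poly_Mapping.single t c) a = c * (\<Prod>i\<in>UNIV. a i ^ Poly_Mapping.lookup t i)"
  by (subst poly_eval_superset[of "{t}"]) auto

lemma poly_eval_add: "poly_eval (f + g) a = poly_eval f a + poly_eval g a"
proof -
  let ?A = "Poly_Mapping.keys f \<union> Poly_Mapping.keys g"
  have "Poly_Mapping.keys (f + g) \<subseteq> ?A"
    by (rule keys_add)
  then show ?thesis
    by (simp add: poly_eval_superset[of ?A] lookup_add distrib_right sum.distrib)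
qed

lemma poly_eval_zero: "poly_eval 0 a = 0"
  by (simp add: poly_eval_def)

lemma poly_eval_sum: "poly_eval (sum f A) a = (\<Sum>x\<in>A. poly_eval (f x) a)"
  by (induction A rule: infinite_finite_induct) (auto simp: poly_eval_add poly_eval_zero)

lemma poly_eval_mult: "poly_eval (f * g) a = poly_eval f a * poly_eval g a"
proof -
  let ?m = "\<lambda>t. \<Prod>i\<in>UNIV. a i ^ Poly_Mapping.lookup t i"
  have "f * g = (\<Sum>s\<in>Poly_Mapping.keys f. \<Sum>t\<in>Poly_Mapping.keys g.
      Poly_Mapping.single (s + t) (Poly_Mapping.lookup f s * Poly_Mapping.lookup g t))"
    by (subst poly_mapping_eq_sum_single[of f], subst poly_mapping_eq_sum_single[of g])
      (simp add: sum_product mult_single)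
  then have "poly_eval (f * g) a = (\<Sum>s\<in>Poly_Mapping.keys f. \<Sum>t\<in>Poly_Mapping.keys g.
      (Poly_Mapping.lookup f s * ?m s) * (Poly_Mapping.lookup g t * ?m t))"
    by (simp add: poly_eval_sum poly_eval_single lookup_add power_add prod.distrib mult_ac)
  also have "\<dots> = poly_eval f a * poly_eval g a"
    unfolding poly_eval_def sum_product ..
  finally show ?thesis .
qed

lemma poly_eval_Const [simp]: "poly_eval (Const c) a = c"
  by (simp add: Const_def poly_eval_single)

lemma poly_eval_Var [simp]: "poly_eval (Var i) a = a i"
proof -
  have "(\<Prod>j\<in>UNIV. a j ^ Poly_Mapping.lookup (Poly_Mapping.single i 1) j) =
      (\<Prod>j\<in>UNIV. if j = i then a j else 1)"
    by (intro prod.cong) (auto simp: lookup_single when_def)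
  then show ?thesis
    by (simp add: Var_def Monom_def poly_eval_single prod.delta)
qed

interpretation Const: comm_ring_hom "Const :: 'a::comm_ring_1 \<Rightarrow> ('m, 'a) mpoly"
  by unfold_locales (auto simp: Const_def single_add mult_single)

interpretation poly_eval: comm_ring_hom
    "\<lambda>f :: ('m::finite, 'a::comm_ring_1) mpoly. poly_eval f a" for a
proof
  show "poly_eval (1 :: ('m, 'a) mpoly) a = 1"
    using poly_eval_Const[of 1 a] by simp
qed (auto simp: poly_eval_zero poly_eval_add poly_eval_mult)

lemma Const_mult_Monom: "Const c * Monom t = Poly_Mapping.single t c"
  by (simp add: Const_def Monom_def mult_single)

lemma lookup_Const_mult: "Poly_Mapping.lookup (Const c * f) t = c * Poly_Mapping.lookup f t"
  by (simp add: Const_def mult_map_scale_conv_mult[symmetric] Poly_Mapping.map.rep_eq when_def)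

lemma keys_Const_mult: "Poly_Mapping.keys (Const c * f) \<subseteq> Poly_Mapping.keys f"
  by (auto simp: in_keys_iff lookup_Const_mult)

section \<open>Structural induction on multivariate polynomials\<close>

lemma Monom_induct:
  fixes P :: "('m::finite, 'a::comm_ring_1) mpoly \<Rightarrow> bool"
  assumes one: "P 1" and var: "\<And>i. P (Var i)" and mult: "\<And>f g. P f \<Longrightarrow> P g \<Longrightarrow> P (f * g)"
  shows "P (Monom t)"
proof -
  have add: "Monom (s + t) = (Monom s * Monom t :: ('m, 'a) mpoly)" for s t
    by (simp add: Monom_def mult_single)
  have zero: "Monom 0 = (1 :: ('m, 'a) mpoly)"
    by (simp add: Monom_def)
  have pow: "P (Monom (Poly_Mapping.single i k))" for i k
  proof (induction k)
    case (Suc k)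
    have "Poly_Mapping.single i (Suc k) = Poly_Mapping.single i 1 + Poly_Mapping.single i k"
      by (simp add: single_add[symmetric])
    then show ?case
      using mult[OF var Suc] by (simp add: add Var_def)
  qed (simp add: zero one)
  \<comment> \<open>The exponent vector \<open>t\<close> is itself a finitely supported map, hence
    the sum of its one-variable parts, and \<open>Monom t\<close> is the corresponding product of
    powers.\<close>
  have "P (Monom (\<Sum>i\<in>A. Poly_Mapping.single i (Poly_Mapping.lookup t i)))" if "finite A" for A
    using that by induction (auto simp: zero one add intro: mult pow)
  from this[OF finite_keys[of t]] show ?thesis
    by (simp flip: poly_mapping_eq_sum_single)
qed

text \<open>Meant for properties closed under sums and products, such as a congruence between
  \<open>f\<close> and its value at a point; only constants and variables then need a
  computation.\<close>

lemma mpoly_induct [case_names Const Var add mult]: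
  fixes P :: "('m::finite, 'a::comm_ring_1) mpoly \<Rightarrow> bool"
  assumes const: "\<And>c. P (Const c)" and var: "\<And>i. P (Var i)"
    and add: "\<And>f g. P f \<Longrightarrow> P g \<Longrightarrow> P (f + g)"
    and mult: "\<And>f g. P f \<Longrightarrow> P g \<Longrightarrow> P (f * g)"
  shows "P f"
proof -
  have one: "P 1" and zero: "P 0"
    using const[of 1] const[of 0] by auto
  have single: "P (Poly_Mapping.single t c)" for t c
    unfolding Const_mult_Monom[symmetric]
    by (rule mult[OF const Monom_induct[where P = P, OF one var mult]])
  have "P (\<Sum>t\<in>A. Poly_Mapping.single t (Poly_Mapping.lookup f t))" if "finite A" for A
    using that by induction (auto intro: add zero single)
  from this[OF finite_keys[of f]] show ?thesis
    by (simp flip: poly_mapping_eq_sum_single)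
qed

section \<open>Ideals\<close>

lemma module_times: "Modules.module ((*) :: 'r::comm_ring_1 \<Rightarrow> 'r \<Rightarrow> 'r)"
  by unfold_locales (auto simp: algebra_simps)

lemma is_ideal_iff:
  "is_ideal J \<longleftrightarrow> 0 \<in> J \<and> (\<forall>x\<in>J. \<forall>y\<in>J. x + y \<in> J) \<and> (\<forall>c. \<forall>x\<in>J. c * x \<in> J)"
  by (rule Modules.module.subspace_def[OF module_times])

lemma ideal_add: "is_ideal J \<Longrightarrow> x \<in> J \<Longrightarrow> y \<in> J \<Longrightarrow> x + y \<in> J"
  by (auto simp: is_ideal_iff)

lemma ideal_mult: "is_ideal J \<Longrightarrow> x \<in> J \<Longrightarrow> c * x \<in> J"
  by (auto simp: is_ideal_iff)

lemma ideal_diff: "is_ideal J \<Longrightarrow> x \<in> J \<Longrightarrow> y \<in> J \<Longrightarrow> x - y \<in> J"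
  by (rule Modules.module.subspace_diff[OF module_times])

lemma ideal_sum: "is_ideal J \<Longrightarrow> (\<And>x. x \<in> A \<Longrightarrow> f x \<in> J) \<Longrightarrow> sum f A \<in> J"
  by (rule Modules.module.subspace_sum[OF module_times])

lemma is_ideal_Iq:
  assumes "is_ideal (I :: ('m::finite, 'a::{field,finite}) mpoly set)"
  shows "is_ideal (Iq I)"
proof -
  let ?K = "ideal_gen {Var i ^ card (UNIV :: 'a set) - Var i | i :: 'm. True} :: ('m, 'a) mpoly set"
  have K: "is_ideal ?K"
    by (rule Modules.module.subspace_span[OF module_times])
  show ?thesis
    unfolding is_ideal_iff
  proof (intro conjI ballI allI)
    show "0 \<in> Iq I"
    proof -
      have "0 \<in> I" "0 \<in> ?K"
        using assms K by (simp_all only: is_ideal_iff)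
      then show ?thesis
        unfolding Iq_def mem_Collect_eq by (intro exI[of _ 0] conjI) simp_all
    qed
  next
    fix x y assume "x \<in> Iq I" "y \<in> Iq I"
    then obtain f g f' g' where "x = f + g" "f \<in> I" "g \<in> ?K" "y = f' + g'" "f' \<in> I" "g' \<in> ?K"
      unfolding Iq_def by blast
    then have "x + y = (f + f') + (g + g')" "f + f' \<in> I" "g + g' \<in> ?K"
      using assms K by (simp_all only: ideal_add) (simp add: algebra_simps)
    then show "x + y \<in> Iq I"
      unfolding Iq_def by blast
  next
    fix c x assume "x \<in> Iq I"
    then obtain f g where "x = f + g" "f \<in> I" "g \<in> ?K"
      unfolding Iq_def by blast
    then have "c * x = c * f + c * g" "c * f \<in> I" "c * g \<in> ?K"
      using assms K by (simp_all only: ideal_mult distrib_left)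
    then show "c * x \<in> Iq I"
      unfolding Iq_def by blast
  qed
qed

lemma field_equation_in_Iq:
  assumes "is_ideal (I :: ('m::finite, 'a::{field,finite}) mpoly set)"
  shows "Var i ^ card (UNIV :: 'a set) - Var i \<in> Iq I"
proof -
  have "0 \<in> I"
    using assms by (simp add: is_ideal_iff)
  moreover have "Var i ^ card (UNIV :: 'a set) - Var i \<in> ideal_gen {Var i ^ card (UNIV :: 'a set) - Var i | i :: 'm. True}"
    by (intro Modules.module.span_base[OF module_times] CollectI exI[of _ i] conjI refl TrueI)
  ultimately show ?thesis
    unfolding Iq_def mem_Collect_eq
    by (intro exI[of _ 0] exI[of _ "Var i ^ card (UNIV :: 'a set) - Var i"] conjI) simp_all
qed

section \<open>Interpolation over a finite field\<close>

lemma card_field_gt_1: "card (UNIV :: 'a::{field,finite} set) > 1"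
  using card_mono[of UNIV "{0, 1 :: 'a}"] by simp

lemma finite_field_power_card:
  fixes x :: "'a::{field,finite}"
  shows "x ^ card (UNIV :: 'a set) = x"
proof (cases "x = 0")
  case False
  \<comment> \<open>Multiplication by \<open>x\<close> permutes the nonzero elements; cancelling
    their product leaves x^(q-1) = 1.\<close>
  have "(\<Prod>y\<in>UNIV - {0}. x * y) = (\<Prod>y\<in>UNIV - {0}. y)"
    by (rule prod.reindex_bij_witness[of _ "\<lambda>y. y / x" "\<lambda>y. x * y"]) (use False in auto)
  then have "x ^ (card (UNIV :: 'a set) - 1) = 1"
    by (simp add: prod.distrib card_Diff_singleton)
  then show ?thesis
    using power_Suc[of x "card (UNIV :: 'a set) - 1"] by (simp add: card_gt_0_iff)
qed (simp add: power_0_left)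

text \<open>A nonzero polynomial of degree below q cannot have all q field elements as roots. The
  bound is put on the difference so that polynomials of degree q with the same leading term can be
  compared as well.\<close>

lemma poly_eq_if_agree_everywhere:
  fixes p r :: "'a::{field,finite} poly"
  assumes "degree (p - r) < card (UNIV :: 'a set)" "\<And>x. poly p x = poly r x"
  shows "p = r"
proof (rule ccontr)
  assume "p \<noteq> r"
  then have "card {x. poly (p - r) x = 0} \<le> degree (p - r)"
    by (intro card_poly_roots_bound) simp
  then show False
    using assms by simp
qed

lemma prod_linear_factors:
  "(\<Prod>s\<in>UNIV. [:- s, 1:]) = [:0, 1:] ^ card (UNIV :: 'a set) - [:0, 1 :: 'a::{field,finite}:]"
    (is "?p = ?x ^ ?q - ?x")
proof (rule poly_eq_if_agree_everywhere)
  note q = card_field_gt_1[where 'a = 'a]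
  have x: "degree (?x ^ ?q) = ?q" "lead_coeff (?x ^ ?q) = 1"
    by (simp add: degree_power_eq) (simp only: lead_coeff_power, simp)
  have p: "degree ?p = ?q" "lead_coeff ?p = 1"
    by (simp add: degree_prod_eq_sum_degree) (simp only: lead_coeff_prod, simp)
  \<comment> \<open>Both polynomials are monic of degree q, so the leading terms cancel. A zero
    difference is treated apart, since its leading coefficient is 0 anyway.\<close>
  have "degree (?p - ?x ^ ?q) < ?q"
  proof (cases "?p = ?x ^ ?q")
    case False
    have "coeff ?p ?q = 1" "coeff (?x ^ ?q) ?q = 1"
      using p x by (simp_all only:)
    then have "coeff (?p - ?x ^ ?q) ?q = 0"
      by (simp only: coeff_diff diff_self)
    then have "degree (?p - ?x ^ ?q) \<noteq> ?q"
      using False by (metis leading_coeff_0_iff right_minus_eq)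
    moreover have "degree (?p - ?x ^ ?q) \<le> ?q"
      by (rule degree_diff_le) (use p x in auto)
    ultimately show ?thesis
      by simp
  qed (use q in simp)
  moreover have "degree ?x < ?q"
    using q by simp
  moreover have "a - (b - c) = (a - b) + c" for a b c :: "'a poly"
    by simp
  ultimately show "degree (?p - (?x ^ ?q - ?x)) < ?q"
    by (simp only: degree_add_less)
  fix x :: 'a
  have "poly ?p x = 0"
    by (auto simp: poly_prod prod_zero_iff)
  then show "poly ?p x = poly (?x ^ ?q - ?x) x"
    by (simp add: finite_field_power_card)
qed

text \<open>Both sides have degree at most q - 1, and at \<open>x\<close> only the summand with
  \<open>a = x\<close> survives, with value 1.\<close>

lemma sum_lagrange_basis:
  "(\<Sum>a\<in>UNIV. \<Prod>s\<in>UNIV - {a}. smult (1 / (a - s)) [:- s, 1:]) = (1 :: 'a::{field,finite} poly)"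
proof (rule poly_eq_if_agree_everywhere)
  let ?l = "\<lambda>a. \<Prod>s\<in>UNIV - {a}. smult (1 / (a - s)) [:- s, 1 :: 'a:]"
  have q: "card (UNIV :: 'a set) > 0"
    by (simp add: card_gt_0_iff)
  have "degree (?l a) \<le> card (UNIV :: 'a set) - 1" for a
  proof -
    have "degree (?l a) \<le> (\<Sum>s\<in>UNIV - {a}. degree (smult (1 / (a - s)) [:- s, 1:]))"
      by (rule order_trans[OF degree_prod_sum_le]) (simp_all add: o_def)
    also have "\<dots> \<le> (\<Sum>s\<in>UNIV - {a}. 1)"
      by (rule sum_mono) (simp add: degree_smult_eq)
    finally show ?thesis
      by (simp add: card_Diff_singleton)
  qed
  then have "degree (sum ?l UNIV - 1) \<le> card (UNIV :: 'a set) - 1"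
    by (intro degree_diff_le degree_sum_le) auto
  then show "degree (sum ?l UNIV - 1) < card (UNIV :: 'a set)"
    using q by linarith
  fix x :: 'a
  have "poly (?l a) x = (if a = x then 1 else 0)" for a
  proof (cases "a = x")
    case True
    have "poly (smult (1 / (a - s)) [:- s, 1:]) a = 1" if "s \<noteq> a" for s
    proof -
      have "poly (smult (1 / (a - s)) [:- s, 1:]) a = 1 / (a - s) * (a - s)"
        by (simp only: poly_smult) simp
      then show ?thesis
        using that by simp
    qed
    then have "(\<Prod>s\<in>UNIV - {a}. poly (smult (1 / (a - s)) [:- s, 1:]) a) = 1"
      by (intro prod.neutral) blast
    then show ?thesis
      using True by (simp only: poly_prod) simp
  qed (auto simp: poly_prod prod_zero_iff)
  then show "poly (sum ?l UNIV) x = poly 1 x"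
    by (simp add: poly_sum)
qed

section \<open>Transport of the univariate identities to multivariate polynomials\<close>

context
  fixes x :: "('m, 'a::{field,finite}) mpoly"
begin

interpretation lift: map_poly_comm_ring_hom "Const :: 'a \<Rightarrow> ('m, 'a) mpoly" ..

lemma prod_minus_Const: "(\<Prod>s\<in>UNIV. x - Const s) = x ^ card (UNIV :: 'a set) - x"
  using arg_cong[OF prod_linear_factors[where 'a = 'a], of "\<lambda>p. poly (map_poly Const p) x"]
  by (simp add: hom_distribs poly_prod)

lemma sum_lagrange_factors:
  "(\<Sum>a\<in>UNIV. \<Prod>s\<in>UNIV - {a}. Const (1 / (a - s)) * (x - Const s)) = 1"
proof -
  have "poly (map_poly Const (smult c [:- s, 1:])) x = Const c * (x - Const s)" for c s :: 'a
    by (simp add: Const.map_poly_hom_smult Const.hom_uminus Const.map_poly_pCons_hom del: smult_pCons)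
  then show ?thesis
    using arg_cong[OF sum_lagrange_basis[where 'a = 'a], of "\<lambda>p. poly (map_poly Const p) x"]
    by (simp only: lift.hom_sum lift.hom_prod poly_prod poly_sum lift.hom_one poly_1)
qed

end

section \<open>Leading monomials and division\<close>

locale monomial_ordering =
  fixes lt :: "'m::finite monomial \<Rightarrow> 'm monomial \<Rightarrow> bool"
  assumes monomial_order: "monomial_order lt"
begin

abbreviation le where "le \<equiv> lt\<^sup>=\<^sup>="

sublocale ord: wellorder le lt
  using monomial_order by (simp add: monomial_order_def)

lemma le_add_mono: "le s t \<Longrightarrow> le (u + s) (u + t)"
  using monomial_order by (auto simp: monomial_order_def add.commute)

lemma lead_monom_eqI:
  assumes "t \<in> Poly_Mapping.keys f" "\<And>s. s \<in> Poly_Mapping.keys f \<Longrightarrow> le s t"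
  shows "lead_monom lt f = t"
  unfolding lead_monom_def
  using assms by (intro the_equality) (auto intro: ord.order.antisym)

lemma lead_monom:
  assumes "f \<noteq> 0"
  shows "lead_monom lt f \<in> Poly_Mapping.keys f"
    and "s \<in> Poly_Mapping.keys f \<Longrightarrow> le s (lead_monom lt f)"
proof -
  have fin: "finite (Poly_Mapping.keys f)" "Poly_Mapping.keys f \<noteq> {}"
    using assms by auto
  have eq: "lead_monom lt f = ord.Max (Poly_Mapping.keys f)"
    using ord.Max_in[OF fin] ord.Max_ge[OF fin(1)] by (intro lead_monom_eqI)
  show "lead_monom lt f \<in> Poly_Mapping.keys f"
    using ord.Max_in[OF fin] by (simp add: eq)
  show "le s (lead_monom lt f)" if "s \<in> Poly_Mapping.keys f"
    using ord.Max_ge[OF fin(1) that] by (simp add: eq)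
qed

text \<open>Adding \<open>u\<close> is injective by cancellation, so a single term of
  \<open>g\<close> contributes to the coefficient at \<open>u + t\<close>.\<close>

lemma lookup_single_mult:
  fixes g :: "('k::cancel_comm_monoid_add) \<Rightarrow>\<^sub>0 ('a::semiring_0)"
  shows "Poly_Mapping.lookup (Poly_Mapping.single u c * g) (u + t) = c * Poly_Mapping.lookup g t"
proof -
  have "Poly_Mapping.single u c * g = (\<Sum>s\<in>Poly_Mapping.keys g.
      Poly_Mapping.single (u + s) (c * Poly_Mapping.lookup g s))"
    by (subst poly_mapping_eq_sum_single[of g]) (simp add: sum_distrib_left mult_single)
  then show ?thesis
    by (simp add: lookup_sum lookup_single when_def in_keys_iff sum.delta' cong: if_cong)
qed

lemma keys_single_mult:
  "Poly_Mapping.keys (Poly_Mapping.single u c * g) \<subseteq> (+) u ` Poly_Mapping.keys g"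
  using keys_mult[of "Poly_Mapping.single u c" g] by (auto split: if_splits)

lemma keys_single_mult_le:
  assumes "g \<noteq> 0" "s \<in> Poly_Mapping.keys (Poly_Mapping.single u c * g)"
  shows "le s (u + lead_monom lt g)"
proof -
  obtain t where "s = u + t" "t \<in> Poly_Mapping.keys g"
    using assms(2) keys_single_mult[of u c g] by blast
  then show ?thesis
    using lead_monom(2)[OF assms(1)] by (simp only: le_add_mono)
qed

text \<open>Multiplying \<open>g\<close> by the cofactor monomial moves its leading monomial to
  \<open>t\<close>, because the ordering is compatible with multiplication.\<close>

lemma monom_dvd_lead_monom_in_ideal:
  fixes J :: "('m, 'a::field) mpoly set"
  assumes "is_ideal J" "g \<in> J" "g \<noteq> 0" "monom_dvd (lead_monom lt g) t"
  obtains f where "f \<in> J" "f \<noteq> 0" "lead_monom lt f = t"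
proof -
  obtain u where u: "t = u + lead_monom lt g"
    using assms(4) by (auto simp: monom_dvd_def add.commute)
  let ?f = "Poly_Mapping.single u 1 * g"
  have t: "t \<in> Poly_Mapping.keys ?f"
    using lead_monom(1)[OF assms(3)] by (simp add: u in_keys_iff lookup_single_mult)
  moreover have "le s t" if "s \<in> Poly_Mapping.keys ?f" for s
    using keys_single_mult_le[OF assms(3) that] by (simp only: u)
  ultimately have "lead_monom lt ?f = t"
    by (intro lead_monom_eqI)
  moreover have "?f \<in> J"
    using assms by (intro ideal_mult)
  moreover have "?f \<noteq> 0"
    using t by auto
  ultimately show thesis
    by (rule that[rotated 2])
qed

lemma footprint_groebner_basis:
  fixes J :: "('m, 'a::field) mpoly set"
  assumes "is_ideal J" "groebner_basis lt J G"
  shows "t \<in> footprint lt J \<longleftrightarrow> (\<forall>g\<in>G. \<not> monom_dvd (lead_monom lt g) t)"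
proof
  assume "t \<in> footprint lt J"
  then show "\<forall>g\<in>G. \<not> monom_dvd (lead_monom lt g) t"
    using assms monom_dvd_lead_monom_in_ideal[of J]
    unfolding footprint_def groebner_basis_def by blast
qed (use assms in \<open>auto simp: footprint_def groebner_basis_def\<close>)

text \<open>The leading monomial of a nonzero \<open>f\<close> would lie in the support of
  \<open>f\<close> and, as a leading monomial of an element of \<open>J\<close>, outside the
  footprint.\<close>

lemma footprint_supported_in_ideal:
  assumes "f \<in> J" "Poly_Mapping.keys f \<subseteq> footprint lt J"
  shows "f = 0"
  using assms lead_monom(1)[of f] unfolding footprint_def by blast

text \<open>The induction runs over an upper bound \<open>t\<close> of the support, not over the
  leading monomial, so that \<open>f = 0\<close> and a missing term at \<open>t\<close> are covered.
  Bounding every monomial of \<open>Q g * g\<close> makes the bound survive the addition of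
  quotients.\<close>

lemma division:
  fixes G :: "('m, 'a::field) mpoly set"
  assumes "finite G" "0 \<notin> G" "\<And>s. s \<in> Poly_Mapping.keys f \<Longrightarrow> le s t"
  shows "\<exists>Q r. f = (\<Sum>g\<in>G. Q g * g) + r \<and>
    (\<forall>g\<in>G. \<forall>s\<in>Poly_Mapping.keys (Q g * g). le s t) \<and>
    (\<forall>s\<in>Poly_Mapping.keys r. \<forall>g\<in>G. \<not> monom_dvd (lead_monom lt g) s)"
  using assms(3)
proof (induction t arbitrary: f rule: ord.less_induct)
  case (less t)
  let ?c = "Poly_Mapping.lookup f t"
  \<comment> \<open>One division step: the term of \<open>f\<close> at \<open>t\<close> is either
    cancelled by a monomial multiple of some \<open>g\<close> or moved to the remainder.\<close>
  obtain Q r where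
    Q: "\<forall>g\<in>G. \<forall>s\<in>Poly_Mapping.keys (Q g * g). le s t" and
    r: "\<forall>s\<in>Poly_Mapping.keys r. s = t \<and> (\<forall>g\<in>G. \<not> monom_dvd (lead_monom lt g) s)" and
    c: "Poly_Mapping.lookup ((\<Sum>g\<in>G. Q g * g) + r) t = ?c"
  proof (cases "\<exists>g\<in>G. monom_dvd (lead_monom lt g) t")
    case True
    then obtain g u where g: "g \<in> G" and u: "t = u + lead_monom lt g"
      by (auto simp: monom_dvd_def add.commute)
    have "g \<noteq> 0"
      using g assms by auto
    let ?q = "Poly_Mapping.single u (?c / Poly_Mapping.lookup g (lead_monom lt g))"
    let ?Q = "\<lambda>h. if h = g then ?q else 0"
    have "(\<Sum>h\<in>G. ?Q h * h) = (\<Sum>h\<in>G. if h = g then ?q * g else 0)"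
      by (intro sum.cong) auto
    then have sum: "(\<Sum>h\<in>G. ?Q h * h) = ?q * g"
      using g assms(1) by simp
    show thesis
    proof (rule that[of ?Q 0])
      have "le s t" if "s \<in> Poly_Mapping.keys (?q * g)" for s
        using keys_single_mult_le[OF \<open>g \<noteq> 0\<close> that] by (simp only: u)
      then show "\<forall>h\<in>G. \<forall>s\<in>Poly_Mapping.keys (?Q h * h). le s t"
        by simp
      have "Poly_Mapping.lookup g (lead_monom lt g) \<noteq> 0"
        using lead_monom(1)[OF \<open>g \<noteq> 0\<close>] by (simp add: in_keys_iff)
      then have "Poly_Mapping.lookup (?q * g) (u + lead_monom lt g) = ?c"
        by (simp add: lookup_single_mult)
      then show "Poly_Mapping.lookup ((\<Sum>h\<in>G. ?Q h * h) + 0) t = ?c"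
        by (simp only: sum add_0_right flip: u)
    qed simp
  next
    case False
    show thesis
      by (rule that[of "\<lambda>_. 0" "Poly_Mapping.single t ?c"]) (use False in auto)
  qed
  define f' where "f' = f - ((\<Sum>g\<in>G. Q g * g) + r)"
  have "Poly_Mapping.lookup f' t = 0"
    using c by (simp add: f'_def lookup_minus)
  moreover have "le s t" if "s \<in> Poly_Mapping.keys f'" for s
  proof (rule ccontr)
    assume "\<not> le s t"
    then have "s \<notin> Poly_Mapping.keys f" "s \<notin> Poly_Mapping.keys r"
      "\<And>g. g \<in> G \<Longrightarrow> s \<notin> Poly_Mapping.keys (Q g * g)"
      using less.prems Q r by auto
    then show False
      using that by (simp add: f'_def in_keys_iff lookup_minus lookup_add lookup_sum)
  qed
  ultimately have small: "lt s t" if "s \<in> Poly_Mapping.keys f'" for s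
    using that by (auto simp: in_keys_iff)
  have "\<exists>Q' r'. f' = (\<Sum>g\<in>G. Q' g * g) + r' \<and>
      (\<forall>g\<in>G. \<forall>s\<in>Poly_Mapping.keys (Q' g * g). le s t) \<and>
      (\<forall>s\<in>Poly_Mapping.keys r'. \<forall>g\<in>G. \<not> monom_dvd (lead_monom lt g) s)"
  \<comment> \<open>The zero polynomial has no leading monomial at which the induction hypothesis
    could be used.\<close>
  proof (cases "f' = 0")
    case True
    then show ?thesis
      by (intro exI[of _ "\<lambda>_. 0"] exI[of _ 0]) simp
  next
    case False
    have "lt (lead_monom lt f') t"
      using small lead_monom(1)[OF False] by blast
    from less.IH[OF this lead_monom(2)[OF False]] this show ?thesis
      by (meson ord.le_less_trans ord.less_imp_le)
  qed
  then obtain Q' r' where f': "f' = (\<Sum>g\<in>G. Q' g * g) + r'" and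
    Q': "\<forall>g\<in>G. \<forall>s\<in>Poly_Mapping.keys (Q' g * g). le s t" and
    r': "\<forall>s\<in>Poly_Mapping.keys r'. \<forall>g\<in>G. \<not> monom_dvd (lead_monom lt g) s"
    by blast
  have "f = f' + ((\<Sum>g\<in>G. Q g * g) + r)"
    by (simp add: f'_def)
  then have "f = (\<Sum>g\<in>G. (Q g + Q' g) * g) + (r + r')"
    by (simp add: f' distrib_right sum.distrib)
  moreover have "\<forall>g\<in>G. \<forall>s\<in>Poly_Mapping.keys ((Q g + Q' g) * g). le s t"
  proof (intro ballI)
    fix g s assume "g \<in> G" "s \<in> Poly_Mapping.keys ((Q g + Q' g) * g)"
    then show "le s t"
      using Q Q' keys_add[of "Q g * g" "Q' g * g"] unfolding distrib_right by blast
  qed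
  moreover have "\<forall>s\<in>Poly_Mapping.keys (r + r'). \<forall>g\<in>G. \<not> monom_dvd (lead_monom lt g) s"
    using r r' keys_add[of r r'] by blast
  ultimately show ?case
    by (intro exI[of _ "\<lambda>g. Q g + Q' g"] exI[of _ "r + r'"] conjI)
qed

lemma is_remainder_exists:
  fixes G :: "('m, 'a::field) mpoly set"
  assumes "finite G" "0 \<notin> G"
  shows "\<exists>r. is_remainder lt G f r"
\<comment> \<open>For \<open>f = 0\<close> the definition of \<open>is_remainder\<close> forces
  every product \<open>Q g * g\<close> to vanish, so zero quotients are chosen.\<close>
proof (cases "f = 0")
  case True
  then show ?thesis
    by (intro exI[of _ 0]) (auto simp: is_remainder_def intro!: exI[of _ "\<lambda>_. 0"])
next
  case False
  from division[OF assms lead_monom(2)[OF False]] obtain Q r where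
    "f = (\<Sum>g\<in>G. Q g * g) + r"
    "\<forall>g\<in>G. \<forall>s\<in>Poly_Mapping.keys (Q g * g). le s (lead_monom lt f)"
    "\<forall>s\<in>Poly_Mapping.keys r. \<forall>g\<in>G. \<not> monom_dvd (lead_monom lt g) s"
    by blast
  with False lead_monom(1) show ?thesis
    unfolding is_remainder_def by blast
qed

section \<open>Remainders modulo a Groebner basis of an ideal\<close>

context
  fixes J G :: "('m, 'a::field) mpoly set"
  assumes J: "is_ideal J" and G: "groebner_basis lt J G"
begin

lemma is_remainder_imp:
  assumes "is_remainder lt G f r"
  shows "f - r \<in> J" "Poly_Mapping.keys r \<subseteq> footprint lt J"
proof -
  have "(\<Sum>g\<in>G. Q g * g) \<in> J" for Q
    using G by (intro ideal_sum[OF J] ideal_mult[OF J]) (auto simp: groebner_basis_def)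
  then show "f - r \<in> J"
    using assms by (auto simp: is_remainder_def)
  show "Poly_Mapping.keys r \<subseteq> footprint lt J"
    using assms by (auto simp: is_remainder_def footprint_groebner_basis[OF J G])
qed

lemma is_remainder_remainder: "is_remainder lt G f (remainder lt G f)"
proof -
  have "\<exists>r. is_remainder lt G f r"
    using G by (intro is_remainder_exists) (auto simp: groebner_basis_def)
  \<comment> \<open>The difference of two remainders lies in \<open>J\<close> and is supported in
    the footprint, hence is zero; this makes the \<open>THE\<close> in \<open>remainder\<close>
    meaningful.\<close>
  moreover have "r = r'" if r: "is_remainder lt G f r" and r': "is_remainder lt G f r'" for r r'
  proof -
    have "(f - r') - (f - r) \<in> J"
      by (rule ideal_diff[OF J is_remainder_imp(1)[OF r'] is_remainder_imp(1)[OF r]])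
    then have "r - r' \<in> J"
      by simp
    moreover have "Poly_Mapping.keys (r - r') \<subseteq> footprint lt J"
      using is_remainder_imp(2)[OF r] is_remainder_imp(2)[OF r'] keys_diff[of r r'] by blast
    ultimately show "r = r'"
      using footprint_supported_in_ideal[of "r - r'" J] by simp
  qed
  ultimately show ?thesis
    unfolding remainder_def by (intro theI'[of "is_remainder lt G f"] ex_ex1I)
qed

lemmas diff_remainder_in_ideal = is_remainder_imp(1)[OF is_remainder_remainder]
lemmas keys_remainder = is_remainder_imp(2)[OF is_remainder_remainder]

end

end

section \<open>The Nullstellensatz for ideals containing the field equations\<close>

context
  fixes J :: "('m::finite, 'a::{field,finite}) mpoly set"
  assumes J: "is_ideal J" and field_equation: "\<And>i. Var i ^ card (UNIV :: 'a set) - Var i \<in> J"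
begin

text \<open>The block of \<open>lagrange_poly a\<close> for the variable \<open>i\<close> lacks
  exactly the linear factor at \<open>a i\<close>. Supplying it completes the product over the whole
  field, which is the field equation for \<open>i\<close>.\<close>

lemma Var_minus_Const_mult_lagrange: "(Var i - Const (a i)) * lagrange_poly a \<in> J"
proof -
  let ?A = "UNIV - {a i}"
  let ?l = "\<lambda>j. \<Prod>s\<in>UNIV - {a j}. Const (1 / (a j - s)) * (Var j - Const s) :: ('m, 'a) mpoly"
  let ?c = "\<Prod>s\<in>?A. Const (1 / (a i - s)) :: ('m, 'a) mpoly"
  let ?r = "\<Prod>j\<in>UNIV - {i}. ?l j"
  have "lagrange_poly a = ?l i * ?r"
    unfolding lagrange_poly_def by (simp add: prod.remove[of _ i])
  also have "?l i = ?c * (\<Prod>s\<in>?A. Var i - Const s)"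
    by (rule prod.distrib)
  finally have "(Var i - Const (a i)) * lagrange_poly a =
      (?c * ?r) * ((Var i - Const (a i)) * (\<Prod>s\<in>?A. Var i - Const s))"
    by (simp only: mult_ac)
  also have "(Var i - Const (a i)) * (\<Prod>s\<in>?A. Var i - Const s) =
      Var i ^ card (UNIV :: 'a set) - Var i"
    unfolding prod_minus_Const[symmetric] by (rule prod.remove[symmetric]) auto
  finally have "(Var i - Const (a i)) * lagrange_poly a =
      (?c * ?r) * (Var i ^ card (UNIV :: 'a set) - Var i)" .
  then show ?thesis
    by (simp only: ideal_mult[OF J field_equation])
qed

text \<open>Modulo \<^term>\<open>J\<close>, the polynomial \<^term>\<open>lagrange_poly a\<close> is a common eigenvector of all
  multiplication maps.\<close>

lemma mult_lagrange_cong: "(f - Const (poly_eval f a)) * lagrange_poly a \<in> J"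
proof (induction f rule: mpoly_induct)
  case (Const c)
  then show ?case
    using J by (simp add: is_ideal_iff)
next
  case (Var i)
  then show ?case
    by (simp add: Var_minus_Const_mult_lagrange)
next
  case (add f g)
  have "(f + g - Const (poly_eval (f + g) a)) * lagrange_poly a =
      (f - Const (poly_eval f a)) * lagrange_poly a + (g - Const (poly_eval g a)) * lagrange_poly a"
    by (simp add: poly_eval_add Const.hom_add algebra_simps)
  then show ?case
    using ideal_add[OF J add] by simp
next
  case (mult f g)
  \<comment> \<open>Writing f g - f(a) g(a) = g (f - f(a)) + f(a) (g - g(a)) reduces the product to
    both induction hypotheses.\<close>
  have "(f * g - Const (poly_eval (f * g) a)) * lagrange_poly a =
      g * ((f - Const (poly_eval f a)) * lagrange_poly a) +
      Const (poly_eval f a) * ((g - Const (poly_eval g a)) * lagrange_poly a)"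
    by (simp add: poly_eval_mult Const.hom_mult algebra_simps)
  then show ?case
    using ideal_add[OF J ideal_mult[OF J mult(1)] ideal_mult[OF J mult(2)]] by simp
qed

lemma sum_lagrange_poly: "(\<Sum>a\<in>UNIV. lagrange_poly a) = (1 :: ('m, 'a) mpoly)"
proof -
  \<comment> \<open>Expanding the product of the univariate sums gives one term for each choice of a
    value per variable, that is, for each point; every univariate sum is 1.\<close>
  have "(\<Sum>a\<in>UNIV. lagrange_poly a) =
      (\<Prod>i\<in>UNIV. \<Sum>b\<in>UNIV. \<Prod>s\<in>UNIV - {b}. Const (1 / (b - s)) * (Var i - Const s :: ('m, 'a) mpoly))"
    unfolding lagrange_poly_def by (subst prod_sum_PiE) (simp_all add: PiE_UNIV_domain)
  also have "\<dots> = 1"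
    unfolding sum_lagrange_factors by simp
  finally show ?thesis .
qed

lemma lagrange_poly_in_ideal:
  assumes "a \<notin> variety J"
  shows "lagrange_poly a \<in> J"
proof -
  obtain h where h: "h \<in> J" "poly_eval h a \<noteq> 0"
    using assms by (auto simp: variety_def)
  let ?c = "Const (poly_eval h a) :: ('m, 'a) mpoly"
  \<comment> \<open>Both products lie in \<open>J\<close>, and their difference is the nonzero
    constant h(a) times \<open>lagrange_poly a\<close>.\<close>
  have "lagrange_poly a * h - (h - ?c) * lagrange_poly a \<in> J"
    by (intro ideal_diff[OF J] ideal_mult[OF J] h mult_lagrange_cong)
  then have "?c * lagrange_poly a \<in> J"
    by (simp add: algebra_simps)
  then have "Const (1 / poly_eval h a) * (?c * lagrange_poly a) \<in> J"
    by (rule ideal_mult[OF J])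
  then show ?thesis
    using h by (simp add: mult.assoc[symmetric] flip: Const.hom_mult)
qed

theorem nullstellensatz:
  assumes "\<And>a. a \<in> variety J \<Longrightarrow> poly_eval f a = 0"
  shows "f \<in> J"
proof -
  have "f * lagrange_poly a \<in> J" for a
  proof (cases "a \<in> variety J")
    case True
    then show ?thesis
      using mult_lagrange_cong[of f a] assms by simp
  next
    case False
    then show ?thesis
      by (intro ideal_mult[OF J] lagrange_poly_in_ideal)
  qed
  then have "(\<Sum>a\<in>UNIV. f * lagrange_poly a) \<in> J"
    by (intro ideal_sum[OF J])
  then show ?thesis
    by (simp add: sum_distrib_left[symmetric] sum_lagrange_poly)
qed

end

lemma poly_eval_lagrange_poly: "poly_eval (lagrange_poly a) b = (if a = b then 1 else 0)"
proof -
  have "poly_eval (lagrange_poly a) b = (\<Prod>i\<in>UNIV. \<Prod>s\<in>UNIV - {a i}. 1 / (a i - s) * (b i - s))"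
    unfolding lagrange_poly_def
    by (simp only: poly_eval.hom_prod poly_eval.hom_mult poly_eval.hom_minus poly_eval_Const
        poly_eval_Var)
  also have "\<dots> = (if a = b then 1 else 0)"
  proof (cases "a = b")
    case True
    then show ?thesis
      by (auto intro!: prod.neutral)
  next
    case False
    then obtain i where "a i \<noteq> b i"
      by auto
    then have "(\<Prod>s\<in>UNIV - {a i}. 1 / (a i - s) * (b i - s)) = 0"
      by (intro prod_zero) (auto intro!: bexI[of _ "b i"])
    then show ?thesis
      using False by (auto intro!: prod_zero)
  qed
  finally show ?thesis .
qed

section \<open>Counting the footprint\<close>

lemma card_supported_poly_mappings:
  assumes "finite T"
  shows "card {f :: 'k \<Rightarrow>\<^sub>0 'a::{zero,finite}. Poly_Mapping.keys f \<subseteq> T} = card (UNIV :: 'a set) ^ card T"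
proof -
  \<comment> \<open>Extension by zero, the inverse of restriction to \<open>T\<close>; finiteness of
    \<open>T\<close> makes the result finitely supported.\<close>
  let ?P = "\<lambda>g :: 'k \<Rightarrow> 'a. Abs_poly_mapping (\<lambda>k. if k \<in> T then g k else 0)"
  have lookup: "Poly_Mapping.lookup (?P g) = (\<lambda>k. if k \<in> T then g k else 0)" for g
  proof (rule Abs_poly_mapping_inverse)
    have "{k. (if k \<in> T then g k else 0) \<noteq> 0} \<subseteq> T"
      by auto
    then show "(\<lambda>k. if k \<in> T then g k else 0) \<in> {f. finite {x. f x \<noteq> 0}}"
      using assms finite_subset by blast
  qed
  have "bij_betw (\<lambda>f :: 'k \<Rightarrow>\<^sub>0 'a. restrict (Poly_Mapping.lookup f) T)
      {f. Poly_Mapping.keys f \<subseteq> T} (PiE T (\<lambda>_. UNIV))"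
    by (rule bij_betw_byWitness[where f' = ?P])
      (auto simp: lookup in_keys_iff fun_eq_iff PiE_def extensional_def intro!: poly_mapping_eqI
        split: if_splits)
  then show ?thesis
    using assms by (simp add: bij_betw_same_card card_PiE)
qed

context monomial_ordering
begin

context
  fixes J G :: "('m, 'a::{field,finite}) mpoly set"
  assumes J: "is_ideal J" and G: "groebner_basis lt J G"
    and field_equation: "\<And>i. Var i ^ card (UNIV :: 'a set) - Var i \<in> J"
begin

lemma footprint_supported_eq_zero:
  assumes "Poly_Mapping.keys f \<subseteq> footprint lt J" "\<And>a. a \<in> variety J \<Longrightarrow> poly_eval f a = 0"
  shows "f = 0"
  using nullstellensatz[OF J field_equation assms(2)] assms(1) by (rule footprint_supported_in_ideal)

lemma poly_eval_remainder_lagrange: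
  assumes "b \<in> variety J"
  shows "poly_eval (remainder lt G (lagrange_poly a)) b = (if a = b then 1 else 0)"
proof -
  have "poly_eval (lagrange_poly a - remainder lt G (lagrange_poly a)) b = 0"
    using diff_remainder_in_ideal[OF J G, of "lagrange_poly a"] assms by (auto simp: variety_def)
  then show ?thesis
    by (simp add: poly_eval.hom_minus poly_eval_lagrange_poly)
qed

text \<open>Evaluation embeds the polynomials supported in \<open>T\<close> into the value tables on
  the variety. \<open>T\<close> is a finite subset because the whole footprint could still be
  infinite here.\<close>

lemma card_footprint_subset_le:
  assumes "finite T" "T \<subseteq> footprint lt J"
  shows "card T \<le> card (variety J)"
proof -
  let ?S = "{f :: ('m, 'a) mpoly. Poly_Mapping.keys f \<subseteq> T}"
  let ?e = "\<lambda>f :: ('m, 'a) mpoly. restrict (poly_eval f) (variety J)"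
  have "inj_on ?e ?S"
  proof (rule inj_onI)
    fix f g assume fg: "f \<in> ?S" "g \<in> ?S" "?e f = ?e g"
    have "poly_eval (f - g) a = 0" if "a \<in> variety J" for a
      using fun_cong[OF fg(3), of a] that by (simp add: poly_eval.hom_minus)
    moreover have "Poly_Mapping.keys (f - g) \<subseteq> footprint lt J"
      using fg assms(2) keys_diff[of f g] by blast
    ultimately have "f - g = 0"
      by (rule footprint_supported_eq_zero[rotated])
    then show "f = g"
      by simp
  qed
  then have "card ?S \<le> card (PiE (variety J) (\<lambda>_. UNIV :: 'a set))"
    by (rule card_inj_on_le) (auto simp: finite_PiE)
  then have "card (UNIV :: 'a set) ^ card T \<le> card (UNIV :: 'a set) ^ card (variety J)"
    using assms(1) by (simp add: card_supported_poly_mappings card_PiE)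
  then show ?thesis
    by (simp add: power_increasing_iff[OF card_field_gt_1])
qed

lemma finite_footprint: "finite (footprint lt J)"
proof (rule ccontr)
  assume "infinite (footprint lt J)"
  then obtain T where "finite T" "card T = Suc (card (variety J))" "T \<subseteq> footprint lt J"
    using infinite_arbitrarily_large by blast
  then show False
    using card_footprint_subset_le[of T] by simp
qed

lemma keys_sum_remainder:
  "Poly_Mapping.keys (\<Sum>x\<in>A. Const (c x) * remainder lt G (h x)) \<subseteq> footprint lt J"
  by (intro order_trans[OF keys_sum] UN_least order_trans[OF keys_Const_mult] keys_remainder[OF J G])

lemma card_footprint: "card (footprint lt J) = card (variety J)"
proof (rule antisym)
  let ?S = "{f :: ('m, 'a) mpoly. Poly_Mapping.keys f \<subseteq> footprint lt J}"
  \<comment> \<open>The interpolation map: \<open>?F h\<close> takes the values of \<open>h\<close>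
    on the variety, so \<open>h\<close> can be recovered from it.\<close>
  let ?F = "\<lambda>h. \<Sum>a\<in>variety J. Const (h a) * remainder lt G (lagrange_poly a)"
  have eval: "poly_eval (?F h) b = h b" if "b \<in> variety J" for h b
  proof -
    have "poly_eval (?F h) b = (\<Sum>a\<in>variety J. if a = b then h a else 0)"
      unfolding poly_eval_sum poly_eval_mult poly_eval_Const poly_eval_remainder_lagrange[OF that]
      by (intro sum.cong) auto
    then show ?thesis
      using that by simp
  qed
  have "inj_on ?F (PiE (variety J) (\<lambda>_. UNIV :: 'a set))"
  proof (rule inj_onI)
    fix g h
    assume "g \<in> PiE (variety J) (\<lambda>_. UNIV)" "h \<in> PiE (variety J) (\<lambda>_. UNIV)"
      and gh: "?F g = ?F h"
    moreover have "g b = h b" if "b \<in> variety J" for b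
      using eval[OF that, of g] eval[OF that, of h] by (simp only: gh)
    ultimately show "g = h"
      by (intro PiE_ext)
  qed
  moreover have fin: "card ?S = card (UNIV :: 'a set) ^ card (footprint lt J)"
    using finite_footprint by (rule card_supported_poly_mappings)
  \<comment> \<open>Finiteness is read off from the positive cardinality, an infinite set having
    \<open>card\<close> 0.\<close>
  moreover have "finite ?S"
    using fin by (intro card_ge_0_finite) (simp add: card_gt_0_iff)
  ultimately have "card (PiE (variety J) (\<lambda>_. UNIV :: 'a set)) \<le> card ?S"
    using keys_sum_remainder by (intro card_inj_on_le[of ?F]) auto
  then have "card (UNIV :: 'a set) ^ card (variety J) \<le> card (UNIV :: 'a set) ^ card (footprint lt J)"
    using fin by (simp add: card_PiE)
  then show "card (variety J) \<le> card (footprint lt J)"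
    by (simp add: power_increasing_iff[OF card_field_gt_1])
qed (use card_footprint_subset_le finite_footprint in auto)

end

end

section \<open>Dual codes\<close>

text \<open>The rows of \<open>B\<close> and the columns of its inverse are dual bases, so the coordinates of \<open>v\<close> in the
  column basis are its scalar products with the rows.\<close>

lemma dual_code_rows:
  fixes B B' :: "'a::field mat"
  assumes B: "B \<in> carrier_mat n n" and B': "B' \<in> carrier_mat n n"
    and BB': "B * B' = 1\<^sub>m n" and B'B: "B' * B = 1\<^sub>m n" and K: "K \<subseteq> {0..<n}"
  shows "dual_code n (code_span n {row B i | i. i \<in> K}) =
    code_span n {col B' j | j. j \<in> {0..<n} - K}" (is "dual_code n (code_span n ?R) = code_span n ?C")
proof -
  interpret vec_space "TYPE('a)" n .
  have row: "row B i \<in> carrier_vec n" and col: "col B' i \<in> carrier_vec n" for i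
    using B B' by (auto intro!: carrier_vecI)
  have R: "?R \<subseteq> carrier_vec n" and C: "?C \<subseteq> carrier_vec n"
    using row col by blast+
  have orth: "row B i \<bullet> col B' j = 0" if "i \<in> K" "j \<in> {0..<n} - K" for i j
  proof -
    have "row B i \<bullet> col B' j = (B * B') $$ (i, j)"
      using that K B B' by (auto simp: subset_iff)
    then show ?thesis
      using that K by (auto simp: BB')
  qed
  have dual: "dual_code n (code_span n ?R) = orthogonal_complement ?R"
    unfolding dual_code_def code_span_def by (rule in_orthogonal_complement_span[OF R])
  \<comment> \<open>Taking complements is insensitive to passing to the span, so the rows are
    orthogonal to all of \<open>span ?C\<close>; symmetry of the scalar product then turns the
    inclusion around.\<close>
  have "?R \<subseteq> orthogonal_complement ?C"
    using R orth by (auto simp: orthogonal_complement_def)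
  then have "?R \<subseteq> orthogonal_complement (span ?C)"
    by (simp only: in_orthogonal_complement_span[OF C])
  then have "y \<bullet> v = 0" if "y \<in> ?R" "v \<in> span ?C" for y v
    using that unfolding orthogonal_complement_def by blast
  then have "v \<bullet> y = 0" if "y \<in> ?R" "v \<in> span ?C" for y v
    using that comm_scalar_prod[OF span_closed[OF C], of v y] R by auto
  then have le: "span ?C \<subseteq> orthogonal_complement ?R"
    using span_closed[OF C] unfolding orthogonal_complement_def by blast
  have ge: "v \<in> span ?C" if v: "v \<in> orthogonal_complement ?R" for v
  proof -
    have v_carrier: "v \<in> carrier_vec n"
      using v by (simp add: orthogonal_complement_def)
    \<comment> \<open>The coordinates of \<open>v\<close> in the basis of columns of
      \<open>B'\<close>. Those with index in \<open>K\<close> vanish because \<open>v\<close> is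
      orthogonal to the corresponding rows.\<close>
    let ?c = "\<lambda>j. row B j \<bullet> v"
    have c: "?c j = 0" if "j \<in> K" for j
    proof -
      have "v \<bullet> row B j = 0" "row B j \<in> carrier_vec n"
        using v that R by (auto simp: orthogonal_complement_def)
      then show ?thesis
        using comm_scalar_prod[OF v_carrier] by simp
    qed
    \<comment> \<open>Partial sums of the expansion of \<open>v\<close>, written entrywise to allow
      induction on \<open>k\<close>; a column outside \<open>?C\<close> enters with coefficient
      0.\<close>
    have "vec n (\<lambda>t. \<Sum>j<k. ?c j * B' $$ (t, j)) \<in> span ?C" if "k \<le> n" for k
      using that
    proof (induction k)
      case 0
      have "vec n (\<lambda>t. \<Sum>j<0. ?c j * B' $$ (t, j)) = 0\<^sub>v n"
        by auto
      then show ?case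
        by (simp only: span_zero)
    next
      case (Suc k)
      have step: "vec n (\<lambda>t. \<Sum>j<Suc k. ?c j * B' $$ (t, j)) =
          vec n (\<lambda>t. \<Sum>j<k. ?c j * B' $$ (t, j)) + ?c k \<cdot>\<^sub>v col B' k"
        using Suc.prems B' by (intro eq_vecI) auto
      have "?c k \<cdot>\<^sub>v col B' k \<in> span ?C"
      proof (cases "k \<in> K")
        case True
        have "?c k \<cdot>\<^sub>v col B' k = 0\<^sub>v n"
          unfolding c[OF True] using B' by (intro eq_vecI) auto
        then show ?thesis
          by (simp only: span_zero)
      next
        case False
        then have "col B' k \<in> ?C"
          using Suc.prems by auto
        then show ?thesis
          using C by (intro smult_in_span span_mem)
      qed
      moreover have "vec n (\<lambda>t. \<Sum>j<k. ?c j * B' $$ (t, j)) \<in> span ?C"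
        using Suc by simp
      ultimately show ?case
        unfolding step using C by (intro span_add1)
    qed
    from this[of n] have "vec n (\<lambda>t. \<Sum>j<n. ?c j * B' $$ (t, j)) \<in> span ?C"
      by simp
    moreover have "vec n (\<lambda>t. \<Sum>j<n. ?c j * B' $$ (t, j)) = B' *\<^sub>v (B *\<^sub>v v)"
      using B B' by (intro eq_vecI) (auto simp: scalar_prod_def atLeast0LessThan mult.commute)
    moreover have "B' *\<^sub>v (B *\<^sub>v v) = (B' * B) *\<^sub>v v"
      by (rule assoc_mult_mat_vec[OF B' B v_carrier, symmetric])
    ultimately show ?thesis
      using v_carrier by (simp add: B'B)
  qed
  show ?thesis
    unfolding dual using le ge by (auto simp: code_span_def)
qed

section \<open>Linearly independent families of polynomials\<close>

lemma module_Const_mult: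
  "Modules.module (\<lambda>c (f :: ('m, 'a::comm_ring_1) mpoly). Const c * f)"
  by unfold_locales (auto simp: algebra_simps Const.hom_add Const.hom_mult)

lemma lin_indep_familyD:
  assumes "lin_indep_family n F" "(\<Sum>i<n. Const (c i) * F i) = 0" "i < n"
  shows "c i = 0"
proof -
  have inj: "inj_on F {0..<n}"
    and indep: "\<not> Modules.module.dependent (\<lambda>c f. Const c * f) (F ` {0..<n})"
    using assms(1) by (auto simp: lin_indep_family_def)
  \<comment> \<open>Independence is stated for the set of values of \<open>F\<close>, so the
    coefficients are moved from indices to polynomials along the inverse of the injective
    \<open>F\<close>.\<close>
  define u where "u = (\<lambda>f. c (inv_into {0..<n} F f))"
  have u: "u (F j) = c j" if "j < n" for j
    using that by (simp add: u_def inv_into_f_f[OF inj])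
  have "(\<Sum>f\<in>F ` {0..<n}. Const (u f) * f) = (\<Sum>j<n. Const (c j) * F j)"
    by (subst sum.reindex[OF inj]) (auto simp: u atLeast0LessThan intro!: sum.cong)
  then have sum: "(\<Sum>f\<in>F ` {0..<n}. Const (u f) * f) = 0"
    by (simp only: assms(2))
  have "\<forall>f\<in>F ` {0..<n}. u f = 0"
  proof (rule ccontr)
    assume "\<not> ?thesis"
    with sum have "\<exists>u. (\<exists>f\<in>F ` {0..<n}. u f \<noteq> 0) \<and> (\<Sum>f\<in>F ` {0..<n}. Const (u f) * f) = 0"
      by (intro exI[of _ u] conjI) blast+
    with indep show False
      by (simp only: Modules.module.dependent_finite[OF module_Const_mult]
          finite_imageI finite_atLeastLessThan simp_thms)
  qed
  then show ?thesis
    using u[OF assms(3)] assms(3) by simp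
qed

lemma lin_indep_family_Monom:
  assumes "inj_on M {0..<n}"
  shows "lin_indep_family n (\<lambda>i. Monom (M i) :: ('m, 'a::comm_ring_1) mpoly)"
proof -
  let ?F = "\<lambda>i. Monom (M i) :: ('m, 'a) mpoly"
  have inj: "inj_on ?F {0..<n}"
    using assms by (auto simp: inj_on_def Monom_def lookup_single dest!: arg_cong[where f = Poly_Mapping.keys])
  have "u f = 0" if sum: "(\<Sum>f\<in>?F ` {0..<n}. Const (u f) * f) = 0" and f: "f \<in> ?F ` {0..<n}"
    for u :: "('m, 'a) mpoly \<Rightarrow> 'a" and f
  proof -
    obtain j where j: "j < n" "f = ?F j"
      using f by auto
    \<comment> \<open>Reading off the coefficient at \<open>M j\<close> isolates the scalar
      belonging to \<open>j\<close>.\<close>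
    have "0 = (\<Sum>i=0..<n. Poly_Mapping.lookup (Poly_Mapping.single (M i) (u (?F i))) (M j))"
      using arg_cong[OF sum, of "\<lambda>p. Poly_Mapping.lookup p (M j)"]
      by (simp add: sum.reindex[OF inj] Const_mult_Monom lookup_sum)
    also have "\<dots> = (\<Sum>i=0..<n. if i = j then u (?F i) else 0)"
      using j(1) assms by (intro sum.cong) (auto simp: lookup_single when_def inj_on_def)
    finally show ?thesis
      using j by simp
  qed
  then have "\<not> Modules.module.dependent (\<lambda>c f. Const c * f) (?F ` {0..<n})"
    unfolding Modules.module.dependent_finite[OF module_Const_mult finite_imageI[OF finite_atLeastLessThan]]
    by blast
  with inj show ?thesis
    by (simp add: lin_indep_family_def)
qed

section \<open>Duals of affine variety codes\<close>

lemma ev_matrix_carrier: "ev_matrix n P F \<in> carrier_mat n n"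
  by (auto simp: ev_matrix_def)

lemma row_ev_matrix: "i < n \<Longrightarrow> row (ev_matrix n P F) i = ev n P (F i)"
  by (simp add: ev_matrix_def ev_def)

lemma ev_matrix_index: "i < n \<Longrightarrow> s < n \<Longrightarrow> ev_matrix n P F $$ (i, s) = poly_eval (F i) (P s)"
  by (simp add: ev_matrix_def ev_def mat_of_rows_index)

context monomial_ordering
begin

context
  fixes J G :: "('m, 'a::{field,finite}) mpoly set" and P :: "nat \<Rightarrow> 'm \<Rightarrow> 'a" and n :: nat
  assumes J: "is_ideal J" and G: "groebner_basis lt J G"
    and field_equation: "\<And>i. Var i ^ card (UNIV :: 'a set) - Var i \<in> J"
    and P: "bij_betw P {0..<n} (variety J)"
begin

lemma variety_eq: "variety J = P ` {0..<n}"
  using P by (simp add: bij_betw_def)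

context
  fixes F :: "nat \<Rightarrow> ('m, 'a) mpoly"
  assumes keys_F: "\<And>i. i < n \<Longrightarrow> Poly_Mapping.keys (F i) \<subseteq> footprint lt J"
    and indep: "lin_indep_family n F"
begin

text \<open>A linear relation between the rows gives a combination of the \<open>F i\<close> that
  vanishes on the variety. Its support lies in the footprint, so it is the zero polynomial, against
  independence.\<close>

lemma det_ev_matrix: "det (ev_matrix n P F) \<noteq> 0"
proof
  let ?B = "ev_matrix n P F"
  assume "det ?B = 0"
  then have "det ?B\<^sup>T = 0"
    by (simp add: det_transpose[OF ev_matrix_carrier])
  then obtain v where v: "v \<in> carrier_vec n" "v \<noteq> 0\<^sub>v n" "?B\<^sup>T *\<^sub>v v = 0\<^sub>v n"
    using det_0_iff_vec_prod_zero_field[of "?B\<^sup>T" n] ev_matrix_carrier[of n P F] by auto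
  let ?f = "\<Sum>i<n. Const (v $ i) * F i"
  have "poly_eval ?f a = 0" if "a \<in> variety J" for a
  proof -
    obtain s where s: "s < n" "a = P s"
      using \<open>a \<in> variety J\<close> variety_eq by auto
    have "poly_eval ?f a = (\<Sum>i<n. ?B $$ (i, s) * v $ i)"
      using s by (simp add: poly_eval_sum poly_eval_mult ev_matrix_index mult.commute)
    also have "\<dots> = (?B\<^sup>T *\<^sub>v v) $ s"
      using s v(1) ev_matrix_carrier[of n P F]
      by (auto simp: scalar_prod_def atLeast0LessThan)
    finally show ?thesis
      using s v(3) by simp
  qed
  moreover have "Poly_Mapping.keys ?f \<subseteq> footprint lt J"
    by (intro order_trans[OF keys_sum] UN_least order_trans[OF keys_Const_mult] keys_F) simp
  ultimately have "?f = 0"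
    by (intro footprint_supported_eq_zero[OF J G field_equation])
  then have "v $ i = 0" if "i < n" for i
    using lin_indep_familyD[OF indep _ that] by blast
  then have "v = 0\<^sub>v n"
    using v(1) by (intro eq_vecI) auto
  then show False
    using v(2) by simp
qed

text \<open>Excludes the value \<open>None\<close>, so that \<open>the\<close> in
  \<open>perp_vec\<close> really yields the inverse matrix.\<close>

lemma mat_inverse_ev_matrix:
  obtains B' where "mat_inverse (ev_matrix n P F) = Some B'" "B' \<in> carrier_mat n n"
    "ev_matrix n P F * B' = 1\<^sub>m n" "B' * ev_matrix n P F = 1\<^sub>m n"
proof (cases "mat_inverse (ev_matrix n P F)")
  case None
  then show ?thesis
    using mat_inverse(1)[OF ev_matrix_carrier None]
      det_non_zero_imp_unit[OF ev_matrix_carrier det_ev_matrix] by metis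
next
  case (Some B')
  then show ?thesis
    using mat_inverse(2)[OF ev_matrix_carrier Some] that by blast
qed

lemma invertible_ev_matrix: "invertible_mat (ev_matrix n P F)"
proof -
  obtain B' where "B' \<in> carrier_mat n n"
    "ev_matrix n P F * B' = 1\<^sub>m n" "B' * ev_matrix n P F = 1\<^sub>m n"
    by (rule mat_inverse_ev_matrix)
  then show ?thesis
    using ev_matrix_carrier[of n P F]
    by (auto simp: invertible_mat_def inverts_mat_def square_mat.simps)
qed

lemma keys_perp_poly: "Poly_Mapping.keys (perp_poly lt G n P F i) \<subseteq> footprint lt J"
  unfolding perp_poly_def by (rule keys_sum_remainder[OF J G field_equation])

lemma ev_perp_poly:
  assumes "i < n"
  shows "ev n P (perp_poly lt G n P F i) = perp_vec n P F i"
proof (rule eq_vecI)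
  obtain B' where B': "mat_inverse (ev_matrix n P F) = Some B'" "B' \<in> carrier_mat n n"
    by (rule mat_inverse_ev_matrix)
  show dim: "dim_vec (ev n P (perp_poly lt G n P F i)) = dim_vec (perp_vec n P F i)"
    using B' by (simp add: ev_def perp_vec_def)
  fix t assume "t < dim_vec (perp_vec n P F i)"
  then have t: "t < n"
    using dim by (simp add: ev_def)
  \<comment> \<open>The remainders evaluate to unit vectors; injectivity of \<open>P\<close> turns
    equality of points into equality of indices.\<close>
  have rem: "poly_eval (remainder lt G (lagrange_poly (P s))) (P t) = (if s = t then 1 else 0)"
    if "s < n" for s
  proof -
    have "P s = P t \<longleftrightarrow> s = t"
      using P that t by (auto simp: bij_betw_def inj_on_def)
    then show ?thesis
      using poly_eval_remainder_lagrange[OF J G field_equation, of "P t" "P s"] t variety_eq by simp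
  qed
  have "poly_eval (perp_poly lt G n P F i) (P t) =
      (\<Sum>s<n. if s = t then perp_vec n P F i $ s else 0)"
    unfolding perp_poly_def poly_eval_sum poly_eval_mult poly_eval_Const
    by (intro sum.cong) (auto simp: rem)
  then show "ev n P (perp_poly lt G n P F i) $ t = perp_vec n P F i $ t"
    using t by (simp add: ev_def)
qed

lemma dual_code_ev:
  assumes K: "K \<subseteq> {0..<n}"
  shows "dual_code n (code_span n {ev n P (F i) | i. i \<in> K}) =
    code_span n {ev n P (perp_poly lt G n P F j) | j. j \<in> {0..<n} - K}"
proof -
  obtain B' where B': "mat_inverse (ev_matrix n P F) = Some B'" "B' \<in> carrier_mat n n"
    "ev_matrix n P F * B' = 1\<^sub>m n" "B' * ev_matrix n P F = 1\<^sub>m n"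
    by (rule mat_inverse_ev_matrix)
  have "{ev n P (F i) | i. i \<in> K} = {row (ev_matrix n P F) i | i. i \<in> K}"
    using K row_ev_matrix[of _ n P F] by (intro Collect_cong ex_cong1) auto
  moreover have "ev n P (perp_poly lt G n P F j) = col B' j" if "j < n" for j
    using ev_perp_poly[OF that] by (simp add: perp_vec_def B')
  then have "{ev n P (perp_poly lt G n P F j) | j. j \<in> {0..<n} - K} =
      {col B' j | j. j \<in> {0..<n} - K}"
    by (intro Collect_cong ex_cong1) auto
  ultimately show ?thesis
    using dual_code_rows[OF ev_matrix_carrier B'(2-4) K] by simp
qed

end

lemma dual_variety_code:
  assumes M: "bij_betw M {0..<n} (footprint lt J)" and L: "L \<subseteq> footprint lt J"
  shows "dual_code n (variety_code n P L) =
    code_span n {ev n P (perp_poly lt G n P (\<lambda>i. Monom (M i)) i) | i. i < n \<and> M i \<notin> L}"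
proof -
  let ?F = "\<lambda>i. Monom (M i) :: ('m, 'a) mpoly"
  let ?K = "{i\<in>{0..<n}. M i \<in> L}"
  have M': "inj_on M {0..<n}" "M ` {0..<n} = footprint lt J"
    using M by (auto simp: bij_betw_def)
  have keys: "Poly_Mapping.keys (?F i) \<subseteq> footprint lt J" if "i < n" for i
    using that M' by (auto simp: Monom_def)
  have L_eq: "L = M ` ?K"
    using L unfolding M'(2)[symmetric] by auto
  have "{ev n P (Monom t :: ('m, 'a) mpoly) | t. t \<in> L} = {ev n P (?F i) | i. i \<in> ?K}"
    by (subst L_eq) auto
  then have "variety_code n P L = code_span n {ev n P (?F i) | i. i \<in> ?K}"
    by (simp only: variety_code_def)
  moreover have "{i. i < n \<and> M i \<notin> L} = {0..<n} - ?K"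
    by auto
  then have "{ev n P (perp_poly lt G n P ?F i) | i. i < n \<and> M i \<notin> L} =
      {ev n P (perp_poly lt G n P ?F i) | i. i \<in> {0..<n} - ?K}"
    by blast
  moreover have "?K \<subseteq> {0..<n}"
    by blast
  ultimately show ?thesis
    by (simp only: dual_code_ev[OF keys lin_indep_family_Monom[OF M'(1)]])
qed

end

end

theorem mainTheorem5:
  fixes I G :: "('m::finite, 'a::{field,finite}) mpoly set"
    and lt :: "'m monomial \<Rightarrow> 'm monomial \<Rightarrow> bool"
    and P :: "nat \<Rightarrow> 'm \<Rightarrow> 'a"
    and n :: nat
  assumes "is_ideal I"
    and "monomial_order lt"
    and "n = card (footprint lt (Iq I))"
    and "bij_betw P {0..<card (variety (Iq I))} (variety (Iq I))"
    and "groebner_basis lt (Iq I) G"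
  shows "finite (footprint lt (Iq I)) \<and> card (variety (Iq I)) = n \<and>
    (\<forall>F :: nat \<Rightarrow> ('m, 'a) mpoly.
       (\<forall>i<n. Poly_Mapping.keys (F i) \<subseteq> footprint lt (Iq I)) \<and> lin_indep_family n F \<longrightarrow>
         invertible_mat (ev_matrix n P F) \<and>
         (\<forall>i<n. Poly_Mapping.keys (perp_poly lt G n P F i) \<subseteq> footprint lt (Iq I) \<and>
                 ev n P (perp_poly lt G n P F i) = perp_vec n P F i) \<and>
         (\<forall>K \<subseteq> {0..<n}.
            dual_code n (code_span n {ev n P (F i) | i. i \<in> K}) =
            code_span n {ev n P (perp_poly lt G n P F j) | j. j \<in> {0..<n} - K})) \<and>
    (\<forall>M :: nat \<Rightarrow> 'm monomial.
       bij_betw M {0..<n} (footprint lt (Iq I)) \<and> (\<forall>i<n. \<forall>j<n. i < j \<longrightarrow> lt (M i) (M j)) \<longrightarrow>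
         (\<forall>L \<subseteq> footprint lt (Iq I).
            dual_code n (variety_code n P L) =
            code_span n {ev n P (perp_poly lt G n P (\<lambda>i. Monom (M i)) i) | i. i < n \<and> M i \<notin> L}))"
proof -
  interpret monomial_ordering lt
    by standard (rule assms(2))
  note J = is_ideal_Iq[OF assms(1)]
  note field_equation = field_equation_in_Iq[OF assms(1)]
  \<comment> \<open>\<open>n\<close> counts the footprint whereas \<open>P\<close> enumerates the
    variety; equating the two counts makes the evaluation matrix square over all points.\<close>
  have card: "card (variety (Iq I)) = n"
    using card_footprint[OF J assms(5) field_equation] assms(3) by simp
  have P: "bij_betw P {0..<n} (variety (Iq I))"
    using assms(4) by (simp only: card)
  note setting = J assms(5) field_equation P
  show ?thesis
    using finite_footprint[OF J assms(5) field_equation] card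
      invertible_ev_matrix[OF setting] keys_perp_poly[OF setting] ev_perp_poly[OF setting]
      dual_code_ev[OF setting] dual_variety_code[OF setting]
    by (intro conjI allI impI) blast+
qed

end
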